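(* For every $n\ge1$, the alternating permutations in $S_{2n}$ are in bijection with the noncrossing arc diagrams on $2n$ points that are perfect matchings.
   Context: An alternating permutation in $S_{2n}$ is a permutation $x$ of $\{1,\ldots,2n\}$ with $x_1>x_2<x_3>x_4<\cdots<x_{2n-1}>x_{2n}$. Place points $1,\ldots,m$ bottom to top on a vertical line. An arc joins a point $p$ to a strictly higher point $q$, moving monotonically upward and passing left or right of each intermediate point; arcs are considered up to combinatorial equivalence (endpoints and set of intermediate points on the left). A noncrossing arc diagram is a collection of arcs such that no two intersect except possibly at endpoints and no two share the same upper endpoint or the same lower endpoint, considered up to combinatorial equivalence. It is a perfect matching if its arcs are pairwise disjoint (even at endpoints) and every point is an endpoint of some arc. *)

theory Defs
  imports "HOL-Analysis.Analysis" "HOL-Combinatorics.Permutations"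
begin

definition alternating_permutations :: "nat \<Rightarrow> (nat \<Rightarrow> nat) set" where
  "alternating_permutations n =
     {x. x permutes {1..2 * n} \<and>
         (\<forall>i\<in>{1..<2 * n}. if odd i then x i > x (i + 1) else x i < x (i + 1))}"

text \<open>The plane is the complex plane and the points \<open>1, \<dots>, m\<close> lie on the imaginary axis.\<close>

definition point :: "nat \<Rightarrow> complex" where
  "point k = Complex 0 (real k)"

text \<open>An arc is an actual curve. It may cross the vertical line between two consecutive points,
  but it avoids the intermediate points, so that it passes left or right of each of them.\<close>

definition is_arc :: "nat \<Rightarrow> (real \<Rightarrow> complex) \<Rightarrow> bool" where
  "is_arc m g \<longleftrightarrow>
     (\<exists>p q. 1 \<le> p \<and> p < q \<and> q \<le> m \<and>
        path g \<and> pathstart g = point p \<and> pathfinish g = point q \<and>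
        strict_mono_on {0..1} (\<lambda>t. Im (g t)) \<and>
        (\<forall>k\<in>{p<..<q}. point k \<notin> path_image g))"

text \<open>The points on the left of an arc are those that the arc passes on their right. Since the height
  is strictly increasing along an arc, its endpoints and the points above or below it are excluded.\<close>

definition left_points :: "(real \<Rightarrow> complex) \<Rightarrow> nat set" where
  "left_points g = {k. \<exists>z\<in>path_image g. Im z = real k \<and> Re z > 0}"

definition arc_shape :: "(real \<Rightarrow> complex) \<Rightarrow> complex \<times> complex \<times> nat set" where
  "arc_shape g = (pathstart g, pathfinish g, left_points g)"

definition noncrossing_arc_diagram :: "nat \<Rightarrow> (real \<Rightarrow> complex) set \<Rightarrow> bool" where
  "noncrossing_arc_diagram m D \<longleftrightarrow>
     (\<forall>g\<in>D. is_arc m g) \<and>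
     pairwise (\<lambda>g h.
        path_image g \<inter> path_image h
          \<subseteq> {pathstart g, pathfinish g} \<inter> {pathstart h, pathfinish h} \<and>
        pathstart g \<noteq> pathstart h \<and> pathfinish g \<noteq> pathfinish h) D"

definition perfect_matching :: "nat \<Rightarrow> (real \<Rightarrow> complex) set \<Rightarrow> bool" where
  "perfect_matching m D \<longleftrightarrow>
     pairwise (\<lambda>g h. disjnt (path_image g) (path_image h)) D \<and>
     (\<forall>k\<in>{1..m}. \<exists>g\<in>D. point k \<in> {pathstart g, pathfinish g})"

text \<open>Distinct arcs of one diagram have distinct lower endpoints, hence distinct shapes; two diagrams
  therefore have equal sets of shapes iff their arcs correspond bijectively to equivalent arcs.\<close>

definition diagram_equiv :: "nat \<Rightarrow> ((real \<Rightarrow> complex) set) rel" where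
  "diagram_equiv m =
     {(D, E). noncrossing_arc_diagram m D \<and> noncrossing_arc_diagram m E \<and>
              arc_shape ` D = arc_shape ` E}"

lemma equiv_diagram_equiv:
  "equiv {D. noncrossing_arc_diagram m D} (diagram_equiv m)"
  by (rule equivI) (auto simp: diagram_equiv_def refl_on_def sym_def trans_def)

definition perfect_matching_diagrams :: "nat \<Rightarrow> (real \<Rightarrow> complex) set set set" where
  "perfect_matching_diagrams m =
     {D. noncrossing_arc_diagram m D \<and> perfect_matching m D} // diagram_equiv m"

end

theory Submission
  imports Defs
begin

text \<open>
  An alternating permutation \<open>x\<close> is cut into the blocks \<open>x\<^sub>1 x\<^sub>2 | x\<^sub>3 x\<^sub>4 | \<dots>\<close>. Each block becomes an
  arc from its smaller to its larger entry, which has on its left exactly the intermediate points of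
  the earlier blocks. Conversely, an arc of a diagram is the graph of a continuous function of the
  height, so by the intermediate value theorem two arcs of a matching with overlapping height ranges
  are strictly ordered from left to right. The blocks of \<open>x\<close> have to be listed in an order compatible
  with this relation such that no arc is directly followed by one lying entirely below it. There is
  exactly one such order, by induction on the number of arcs: the arc \<open>h\<close> with the highest lower
  endpoint stands immediately before its first right neighbour, or last if it has none. Indeed \<open>h\<close>
  lies above every arc whose height range does not overlap its own, so only a right neighbour can
  follow it; and the height ranges overlapping that of \<open>h\<close> all contain its lower endpoint, at which
  the arcs are linearly ordered.
\<close>

section \<open>Admissible orders\<close>

text \<open>Read \<open>L a b\<close> as \<open>a\<close> lying to the left of \<open>b\<close>.
  Only reversals of \<open>L\<close> are forbidden, since arcs whose height ranges do not overlap
  are incomparable. The condition on neighbours encodes the ascents between consecutive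
  blocks.\<close>

definition admissible_order ::
  "('a \<Rightarrow> nat) \<Rightarrow> ('a \<Rightarrow> nat) \<Rightarrow> ('a \<Rightarrow> 'a \<Rightarrow> bool) \<Rightarrow> 'a set \<Rightarrow> 'a list \<Rightarrow> bool" where
  "admissible_order lo hi L D xs \<longleftrightarrow>
     distinct xs \<and> set xs = D \<and> sorted_wrt (\<lambda>a b. \<not> L b a) xs \<and>
     successively (\<lambda>a b. lo a < hi b) xs"

text \<open>Sortedness keeps right neighbours of \<open>h\<close> out of the part before
  \<open>h\<close>. The element right after \<open>h\<close> reaches above \<open>lo h\<close>,
  hence is comparable with \<open>h\<close> and must be a right neighbour. So the rest of the list
  determines the position of \<open>h\<close>.\<close>

lemma admissible_order_remove_highest:
  fixes lo hi :: "'a \<Rightarrow> nat"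
  assumes xs: "admissible_order lo hi L (insert h D) xs" and "h \<notin> D"
    and highest: "\<And>a. a \<in> D \<Longrightarrow> lo a \<le> lo h" and "lo h < hi h"
    and total: "\<And>a. a \<in> D \<Longrightarrow> lo h < hi a \<Longrightarrow> L h a \<or> L a h"
  shows "\<exists>ys. admissible_order lo hi L D ys \<and>
           xs = takeWhile (\<lambda>a. \<not> L h a) ys @ h # dropWhile (\<lambda>a. \<not> L h a) ys"
proof -
  have "h \<in> set xs"
    using xs by (auto simp: admissible_order_def)
  then obtain us vs where split: "xs = us @ h # vs"
    by (meson split_list)
  have dist: "distinct xs" "set xs = insert h D" and sorted: "sorted_wrt (\<lambda>a b. \<not> L b a) xs"
    and succ: "successively (\<lambda>a b. lo a < hi b) xs"
    using xs by (auto simp: admissible_order_def)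
  have D: "set us \<union> set vs = D"
    using dist split \<open>h \<notin> D\<close> by auto
  have us: "\<not> L h a" if "a \<in> set us" for a
    using sorted split that by (auto simp: sorted_wrt_append)
  have vs: "lo h < hi (hd vs) \<and> L h (hd vs)" if "vs \<noteq> []"
  proof -
    have "hd vs \<in> set vs" using that by simp
    moreover have lt: "lo h < hi (hd vs)"
      using succ split that by (cases vs) (auto simp: successively_append_iff)
    moreover have "\<not> L (hd vs) h"
      using sorted split \<open>hd vs \<in> set vs\<close> by (auto simp: sorted_wrt_append)
    ultimately show ?thesis using total D by blast
  qed
  have "takeWhile (\<lambda>a. \<not> L h a) (us @ vs) = us \<and> dropWhile (\<lambda>a. \<not> L h a) (us @ vs) = vs"
    using us vs by (cases vs) auto
  moreover have "admissible_order lo hi L D (us @ vs)"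
    unfolding admissible_order_def
  proof (intro conjI)
    show "distinct (us @ vs)" "set (us @ vs) = D"
      using dist split D by auto
    show "sorted_wrt (\<lambda>a b. \<not> L b a) (us @ vs)"
      using sorted split by (auto simp: sorted_wrt_append)
    \<comment> \<open>The gap left by \<open>h\<close> closes because
      \<open>lo (last us) \<le> lo h < hi (hd vs)\<close>.\<close>
    have "lo (last us) < hi (hd vs)" if "us \<noteq> []" "vs \<noteq> []"
      using vs that highest[of "last us"] D by fastforce
    then show "successively (\<lambda>a b. lo a < hi b) (us @ vs)"
      using succ split by (auto simp: successively_append_iff successively_Cons)
  qed
  ultimately show ?thesis
    using split by metis
qed

lemma admissible_order_unique:
  fixes lo hi :: "'a \<Rightarrow> nat"
  assumes "finite D" and "\<And>a. a \<in> D \<Longrightarrow> lo a < hi a"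
    and "\<And>a b. a \<in> D \<Longrightarrow> b \<in> D \<Longrightarrow> a \<noteq> b \<Longrightarrow> lo a < hi b \<Longrightarrow> lo b < hi a \<Longrightarrow> L a b \<or> L b a"
    and "admissible_order lo hi L D xs" "admissible_order lo hi L D ys"
  shows "xs = ys"
  using assms
\<comment> \<open>This rule adds elements by nondecreasing \<open>lo\<close>, so \<open>h\<close>
  always has the highest lower endpoint. It does not promise that \<open>h\<close> is new, whence
  the case \<open>h \<in> D\<close>.\<close>
proof (induction D arbitrary: xs ys rule: finite_ranking_induct[where f = lo])
  case empty
  then show ?case by (simp add: admissible_order_def)
next
  case (insert h D)
  show ?case
  proof (cases "h \<in> D")
    case True
    then show ?thesis using insert by (simp add: insert_absorb)
  next
    case False
    have tot: "L h a \<or> L a h" if "a \<in> D" "lo h < hi a" for a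
    proof -
      have "lo a < hi h" using insert.hyps(2)[OF that(1)] insert.prems(1)[of h] by simp
      then show ?thesis using insert.prems(2)[of h a] that False by blast
    qed
    have rem: "\<exists>ys. admissible_order lo hi L D ys \<and>
           zs = takeWhile (\<lambda>a. \<not> L h a) ys @ h # dropWhile (\<lambda>a. \<not> L h a) ys"
      if "admissible_order lo hi L (insert h D) zs" for zs
    proof (rule admissible_order_remove_highest[OF that False])
      show "lo h < hi h" using insert.prems(1) by simp
    qed (use insert.hyps(2) tot in simp_all)
    obtain xs' where xs': "admissible_order lo hi L D xs'"
      "xs = takeWhile (\<lambda>a. \<not> L h a) xs' @ h # dropWhile (\<lambda>a. \<not> L h a) xs'"
      using rem insert.prems(3) by blast
    obtain ys' where ys': "admissible_order lo hi L D ys'"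
      "ys = takeWhile (\<lambda>a. \<not> L h a) ys' @ h # dropWhile (\<lambda>a. \<not> L h a) ys'"
      using rem insert.prems(4) by blast
    have "xs' = ys'"
    proof (rule insert.IH)
      show "lo a < hi a" if "a \<in> D" for a
        using insert.prems(1) that by simp
      show "L a b \<or> L b a" if "a \<in> D" "b \<in> D" "a \<noteq> b" "lo a < hi b" "lo b < hi a" for a b
        using insert.prems(2)[of a b] that by simp
    qed fact+
    then show ?thesis using xs' ys' by simp
  qed
qed

text \<open>The element \<open>h\<close> is inserted before its first right neighbour. Transitivity
  is assumed only when the outer two ranges overlap, because \<open>L\<close> relates overlapping
  arcs only.\<close>

lemma admissible_order_exists:
  fixes lo hi :: "'a \<Rightarrow> nat"
  assumes "finite D" and "\<And>a. a \<in> D \<Longrightarrow> lo a < hi a"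
    and "\<And>a b. a \<in> D \<Longrightarrow> b \<in> D \<Longrightarrow> L a b \<Longrightarrow> lo a < hi b \<and> lo b < hi a \<and> \<not> L b a"
    and "\<And>a b c. a \<in> D \<Longrightarrow> b \<in> D \<Longrightarrow> c \<in> D \<Longrightarrow> L a b \<Longrightarrow> L b c \<Longrightarrow>
           lo a < hi c \<Longrightarrow> lo c < hi a \<Longrightarrow> L a c"
  shows "\<exists>xs. admissible_order lo hi L D xs"
  using assms
proof (induction D rule: finite_ranking_induct[where f = lo])
  case empty
  have "admissible_order lo hi L {} []" by (simp add: admissible_order_def)
  then show ?case ..
next
  case (insert h D)
  have "\<exists>xs. admissible_order lo hi L D xs"
  proof (rule insert.IH)
    show "lo a < hi a" if "a \<in> D" for a
      using insert.prems(1) that by simp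
    show "lo a < hi b \<and> lo b < hi a \<and> \<not> L b a" if "a \<in> D" "b \<in> D" "L a b" for a b
      using insert.prems(2)[of a b] that by simp
    show "L a c" if "a \<in> D" "b \<in> D" "c \<in> D" "L a b" "L b c" "lo a < hi c" "lo c < hi a" for a b c
      using insert.prems(3)[of a b c] that by simp
  qed
  then obtain xs where xs: "admissible_order lo hi L D xs" ..
  show ?case
  proof (cases "h \<in> D")
    case True
    then show ?thesis using xs by (auto simp: insert_absorb)
  next
    case False
    define us vs where "us = takeWhile (\<lambda>a. \<not> L h a) xs" and "vs = dropWhile (\<lambda>a. \<not> L h a) xs"
    have split: "xs = us @ vs" by (simp add: us_def vs_def)
    have dist: "distinct xs" "set xs = D" and sorted: "sorted_wrt (\<lambda>a b. \<not> L b a) xs"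
      and succ: "successively (\<lambda>a b. lo a < hi b) xs"
      using xs by (auto simp: admissible_order_def)
    have us: "\<not> L h a" if "a \<in> set us" for a
      using that unfolding us_def by (auto dest: set_takeWhileD)
    have hd: "L h (hd vs)" if "vs \<noteq> []"
      using that hd_dropWhile[of "\<lambda>a. \<not> L h a" xs] unfolding vs_def by simp
    \<comment> \<open>If \<open>c\<close> in the right part were left of \<open>h\<close>, then
      \<open>L c h\<close> and \<open>L h b\<close> for the first element \<open>b\<close> of that
      part. The ranges of \<open>b\<close> and \<open>c\<close> both contain the height
      \<open>lo h\<close>, so transitivity gives \<open>L c b\<close>, against sortedness.\<close>
    have vs: "\<not> L c h" if c: "c \<in> set vs" for c
    proof
      assume ch: "L c h"
      obtain b ws where bws: "vs = b # ws" using c by (cases vs) auto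
      have hb: "L h b" using hd bws by simp
      have inD: "b \<in> D" "c \<in> D" using split dist bws c by auto
      then have "c \<noteq> b" using ch hb insert.prems(2)[of h b] by auto
      then have "\<not> L c b" using c bws sorted split by (auto simp: sorted_wrt_append)
      moreover have "L c b"
      proof (rule insert.prems(3)[of c h b])
        show "L c h" "L h b" by fact+
        have "lo h < hi c" "lo h < hi b"
          using insert.prems(2)[of c h] insert.prems(2)[of h b] ch hb inD by auto
        then show "lo c < hi b" "lo b < hi c" using insert.hyps(2)[of b] insert.hyps(2)[of c] inD by simp_all
      qed (use inD in auto)
      ultimately show False by simp
    qed
    have "admissible_order lo hi L (insert h D) (us @ h # vs)"
      unfolding admissible_order_def
    proof (intro conjI)
      show "distinct (us @ h # vs)" "set (us @ h # vs) = insert h D"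
        using dist split False by auto
      show "sorted_wrt (\<lambda>a b. \<not> L b a) (us @ h # vs)"
        using sorted split us vs by (auto simp: sorted_wrt_append)
      have "lo (last us) < hi h" if "us \<noteq> []"
      proof -
        have "last us \<in> D" using that split dist by auto
        then show ?thesis using insert.hyps(2)[of "last us"] insert.prems(1)[of h] by simp
      qed
      moreover have "lo h < hi (hd vs)" if "vs \<noteq> []"
      proof -
        have "hd vs \<in> D" using that split dist by auto
        then show ?thesis using insert.prems(2)[of h "hd vs"] hd that by simp
      qed
      ultimately show "successively (\<lambda>a b. lo a < hi b) (us @ h # vs)"
        using succ split by (auto simp: successively_append_iff successively_Cons)
    qed
    then show ?thesis ..
  qed
qed

section \<open>Arcs as graphs over the vertical line\<close>

lemma point_simps [simp]: "point j = point k \<longleftrightarrow> j = k" "Im (point k) = real k" "Re (point k) = 0"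
  by (auto simp: point_def)

definition arc_graph ::
  "nat \<Rightarrow> (real \<Rightarrow> complex) \<Rightarrow> nat \<Rightarrow> nat \<Rightarrow> (real \<Rightarrow> real) \<Rightarrow> bool" where
  "arc_graph m g p q X \<longleftrightarrow>
     1 \<le> p \<and> p < q \<and> q \<le> m \<and> pathstart g = point p \<and> pathfinish g = point q \<and>
     continuous_on {real p..real q} X \<and> path_image g = (\<lambda>y. Complex (X y) y) ` {real p..real q} \<and>
     X (real p) = 0 \<and> X (real q) = 0"

text \<open>The height is a strictly increasing continuous map of \<open>{0..1}\<close> onto
  \<open>{real p..real q}\<close>; its inverse is continuous by compactness. Following the arc along
  this inverse gives \<open>X\<close>, the horizontal coordinate as a function of the
  height.\<close>

lemma is_arc_imp_arc_graph:
  assumes "is_arc m g"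
  shows "\<exists>p q X. arc_graph m g p q X"
proof -
  obtain p q where pq: "1 \<le> p" "p < q" "q \<le> m" and g: "path g" "pathstart g = point p"
    "pathfinish g = point q" and mono: "strict_mono_on {0..1} (\<lambda>t. Im (g t))"
    using assms unfolding is_arc_def by blast
  let ?h = "\<lambda>t. Im (g t)"
  have cont: "continuous_on {0..1} g" using g by (simp add: path_def)
  then have conth: "continuous_on {0..1} ?h" by (intro continuous_intros)
  have inj: "inj_on ?h {0..1}" using mono by (rule strict_mono_on_imp_inj_on)
  have ends: "?h 0 = real p" "?h 1 = real q"
    using g by (auto simp: pathstart_def pathfinish_def)
  have img: "?h ` {0..1} = {real p..real q}"
  proof
    show "?h ` {0..1} \<subseteq> {real p..real q}"
      using strict_mono_on_leD[OF mono, of 0] strict_mono_on_leD[OF mono, of _ 1] ends by fastforce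
    show "{real p..real q} \<subseteq> ?h ` {0..1}"
      using connected_contains_Icc[OF connected_continuous_image[OF conth connected_Icc],
          of "real p" "real q"] ends
      by (metis atLeastAtMost_iff image_eqI order.refl zero_le_one)
  qed
  define s where "s = the_inv_into {0..1} ?h"
  have s: "s (?h t) = t" if "t \<in> {0..1}" for t
    using the_inv_into_f_f[OF inj] that by (simp add: s_def)
  have conts: "continuous_on {real p..real q} s"
    using continuous_on_inv[OF conth, of s] s img by auto
  have sin: "s y \<in> {0..1}" "?h (s y) = y" if "y \<in> {real p..real q}" for y
    using that s unfolding img[symmetric] by auto
  define X where "X = (\<lambda>y. Re (g (s y)))"
  have gs: "g (s y) = Complex (X y) y" if "y \<in> {real p..real q}" for y
    using sin[OF that] by (simp add: X_def complex_eq_iff)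
  have contX: "continuous_on {real p..real q} X"
    unfolding X_def
    by (intro continuous_intros continuous_on_compose2[OF cont conts]) (use sin in auto)
  have "s ` {real p..real q} = {0..1}"
    unfolding img[symmetric] image_image using s by simp
  then have "path_image g = (\<lambda>y. g (s y)) ` {real p..real q}"
    unfolding path_image_def by (metis image_image)
  also have "\<dots> = (\<lambda>y. Complex (X y) y) ` {real p..real q}"
    using gs by (intro image_cong) auto
  finally have pim: "path_image g = (\<lambda>y. Complex (X y) y) ` {real p..real q}" .
  have "s (real p) = 0" "s (real q) = 1"
    using s[of 0] s[of 1] ends by auto
  then have "X (real p) = 0" "X (real q) = 0"
    using g by (auto simp: X_def pathstart_def pathfinish_def)
  then show ?thesis using pq g contX pim unfolding arc_graph_def by blast
qed

text \<open>A positive \<open>X\<close> at height \<open>k\<close> means that the curve passes to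
  the right of point \<open>k\<close>. The zeros of \<open>X\<close> at both ends exclude the
  endpoints.\<close>

lemma left_points_graph:
  assumes "path_image g = (\<lambda>y. Complex (X y) y) ` {real p..real q}"
    and "X (real p) = 0" "X (real q) = 0"
  shows "left_points g = {k \<in> {p<..<q}. X (real k) > 0}"
proof -
  have "left_points g = {k \<in> {p..q}. X (real k) > 0}"
    unfolding left_points_def assms(1) by auto
  also have "\<dots> = {k \<in> {p<..<q}. X (real k) > 0}"
    using assms by (auto simp: le_less)
  finally show ?thesis .
qed

text \<open>Intermediate value theorem for the difference of the two functions.\<close>

lemma nonvanishing_difference_sign:
  fixes f g :: "real \<Rightarrow> real"
  assumes "continuous_on {a..b} f" "continuous_on {a..b} g" "\<And>y. y \<in> {a..b} \<Longrightarrow> f y \<noteq> g y"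
    and "y \<in> {a..b}" "z \<in> {a..b}" "f y < g y"
  shows "f z < g z"
proof (rule ccontr)
  assume "\<not> f z < g z"
  then have "g z - f z \<le> 0" "0 \<le> g y - f y" using assms(6) by auto
  moreover have "connected ((\<lambda>t. g t - f t) ` {a..b})"
    by (intro connected_continuous_image continuous_intros assms connected_Icc)
  ultimately have "0 \<in> (\<lambda>t. g t - f t) ` {a..b}"
    using assms(4,5) connectedD_interval by blast
  then show False using assms(3) by fastforce
qed

section \<open>Shapes of alternating permutations\<close>

text \<open>Blocks are numbered from \<open>0\<close>, positions from \<open>1\<close>.\<close>

definition block_arc :: "(nat \<Rightarrow> nat) \<Rightarrow> nat \<Rightarrow> nat \<times> nat" where
  "block_arc x i = (x (2 * i + 2), x (2 * i + 1))"

definition block_shape :: "(nat \<Rightarrow> nat) \<Rightarrow> nat \<Rightarrow> complex \<times> complex \<times> nat set" where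
  "block_shape x i =
     (point (x (2 * i + 2)), point (x (2 * i + 1)),
      {k \<in> {x (2 * i + 2)<..<x (2 * i + 1)}. k \<in> x ` {1..2 * i}})"

lemma image_blocks: "x ` {1..2 * n} = (\<Union>i<n. {x (2 * i + 1), x (2 * i + 2)})"
  for x :: "nat \<Rightarrow> 'a"
proof (induction n)
  case (Suc n)
  have "{1..2 * Suc n} = insert (2 * n + 1) (insert (2 * n + 2) {1..2 * n})"
    by auto
  then show ?case using Suc by (auto simp: lessThan_Suc)
qed simp

lemma alternating_permutationsD:
  assumes "x \<in> alternating_permutations n"
  shows "x permutes {1..2 * n}"
    and "i < n \<Longrightarrow> x (2 * i + 2) < x (2 * i + 1)"
    and "Suc i < n \<Longrightarrow> x (2 * i + 2) < x (2 * Suc i + 1)"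
proof -
  show "x permutes {1..2 * n}"
    using assms by (simp add: alternating_permutations_def)
  have alt: "\<And>j. j \<in> {1..<2 * n} \<Longrightarrow> if odd j then x j > x (j + 1) else x j < x (j + 1)"
    using assms unfolding alternating_permutations_def by blast
  show "i < n \<Longrightarrow> x (2 * i + 2) < x (2 * i + 1)"
    using alt[of "2 * i + 1"] by simp
  show "Suc i < n \<Longrightarrow> x (2 * i + 2) < x (2 * Suc i + 1)"
    using alt[of "2 * i + 2"] by simp
qed

lemma alternating_permutations_range:
  assumes "x \<in> alternating_permutations n" "j \<in> {1..2 * n}"
  shows "x j \<in> {1..2 * n}"
  using alternating_permutationsD(1)[OF assms(1)] assms(2) by (simp only: permutes_in_image)

lemma alternating_permutations_inj:
  assumes "x \<in> alternating_permutations n"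
  shows "x i = x j \<longleftrightarrow> i = j"
  using permutes_inj[OF alternating_permutationsD(1)[OF assms]] by (simp add: inj_eq)

text \<open>Whether one of two arcs with overlapping height ranges lies left of the other can be read off
  the shape of either arc at the higher of the two lower endpoints.\<close>

definition left_arc :: "(complex \<times> complex \<times> nat set) set \<Rightarrow> nat \<times> nat \<Rightarrow> nat \<times> nat \<Rightarrow> bool" where
  "left_arc T a b \<longleftrightarrow>
     (fst b < fst a \<and> fst a < snd b \<and> (\<exists>A. (point (fst b), point (snd b), A) \<in> T \<and> fst a \<in> A)) \<or>
     (fst a < fst b \<and> fst b < snd a \<and> (\<exists>A. (point (fst a), point (snd a), A) \<in> T \<and> fst b \<notin> A))"

text \<open>By injectivity of \<open>x\<close>, the endpoints of a block identify it among all
  blocks, so they leave only one choice for the third component.\<close>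

lemma block_shape_lookup:
  assumes x: "x \<in> alternating_permutations n" and "i < n"
  shows "(point (fst (block_arc x i)), point (snd (block_arc x i)), A) \<in> block_shape x ` {..<n} \<longleftrightarrow>
    A = {k \<in> {x (2 * i + 2)<..<x (2 * i + 1)}. k \<in> x ` {1..2 * i}}"
  using assms(2) by (auto simp: block_shape_def block_arc_def alternating_permutations_inj[OF x])

text \<open>When two distinct blocks overlap, the higher of the lower endpoints lies strictly inside
  the other range, and it is on the left of that arc exactly if its own block comes earlier. Thus
  the set of shapes already knows the order of overlapping blocks.\<close>

lemma left_arc_block:
  assumes x: "x \<in> alternating_permutations n" and "i < n" "j < n"
  shows "left_arc (block_shape x ` {..<n}) (block_arc x i) (block_arc x j) \<longleftrightarrow>
    fst (block_arc x i) < snd (block_arc x j) \<and> fst (block_arc x j) < snd (block_arc x i) \<and> i < j"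
proof -
  have mem: "x (2 * k + 2) \<in> x ` {1..2 * l} \<longleftrightarrow> k < l" for k l
    by (auto simp: image_iff alternating_permutations_inj[OF x])
  have lt: "x (2 * i + 2) < x (2 * i + 1)" "x (2 * j + 2) < x (2 * j + 1)"
    using alternating_permutationsD(2)[OF x] assms by auto
  have "x (2 * i + 2) = x (2 * j + 2) \<longleftrightarrow> i = j"
    using alternating_permutations_inj[OF x] by auto
  then show ?thesis
    unfolding left_arc_def block_shape_lookup[OF x \<open>i < n\<close>] block_shape_lookup[OF x \<open>j < n\<close>]
    using lt by (cases "x (2 * i + 2)" "x (2 * j + 2)" rule: linorder_cases)
      (auto simp: block_arc_def mem simp del: One_nat_def add_2_eq_Suc add_2_eq_Suc')
qed

lemma admissible_order_blocks:
  assumes x: "x \<in> alternating_permutations n"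
  shows "admissible_order fst snd (left_arc (block_shape x ` {..<n})) (block_arc x ` {..<n})
           (map (block_arc x) [0..<n])"
  unfolding admissible_order_def
proof (intro conjI)
  have "inj (block_arc x)"
    by (auto intro!: injI simp: block_arc_def alternating_permutations_inj[OF x])
  then show "distinct (map (block_arc x) [0..<n])"
    by (auto simp: distinct_map intro: inj_on_subset)
  show "set (map (block_arc x) [0..<n]) = block_arc x ` {..<n}"
    by (simp add: lessThan_atLeast0)
  show "sorted_wrt (\<lambda>a b. \<not> left_arc (block_shape x ` {..<n}) b a) (map (block_arc x) [0..<n])"
    by (auto simp: sorted_wrt_iff_nth_less left_arc_block[OF x])
  show "successively (\<lambda>a b. fst a < snd b) (map (block_arc x) [0..<n])"
    using alternating_permutationsD(3)[OF x] by (auto simp: successively_conv_nth block_arc_def)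
qed

text \<open>The set of shapes determines both the set of blocks and the relation
  \<open>left_arc\<close>. Uniqueness of admissible orders then recovers the sequence of blocks,
  hence the permutation.\<close>

lemma inj_on_block_shapes:
  "inj_on (\<lambda>x. block_shape x ` {..<n}) (alternating_permutations n)"
proof (rule inj_onI)
  fix x y
  assume x: "x \<in> alternating_permutations n" and y: "y \<in> alternating_permutations n"
    and eq: "block_shape x ` {..<n} = block_shape y ` {..<n}"
  let ?T = "block_shape x ` {..<n}"
  \<comment> \<open>The height of \<open>point k\<close> is \<open>k\<close>, so the floor of the
    imaginary part returns the label.\<close>
  have ends: "block_arc z ` {..<n} =
      (\<lambda>(p, q, A). (nat \<lfloor>Im p\<rfloor>, nat \<lfloor>Im q\<rfloor>)) ` block_shape z ` {..<n}" for z
    by (simp add: image_image block_arc_def block_shape_def)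
  have D: "block_arc x ` {..<n} = block_arc y ` {..<n}"
    unfolding ends eq ..
  have "map (block_arc x) [0..<n] = map (block_arc y) [0..<n]"
  proof (rule admissible_order_unique)
    show "admissible_order fst snd (left_arc ?T) (block_arc x ` {..<n}) (map (block_arc x) [0..<n])"
      by (rule admissible_order_blocks[OF x])
    show "admissible_order fst snd (left_arc ?T) (block_arc x ` {..<n}) (map (block_arc y) [0..<n])"
      unfolding eq D by (rule admissible_order_blocks[OF y])
    show "fst a < snd a" if "a \<in> block_arc x ` {..<n}" for a
      using that alternating_permutationsD(2)[OF x] by (auto simp: block_arc_def)
    show "left_arc ?T a b \<or> left_arc ?T b a"
      if ab: "a \<in> block_arc x ` {..<n}" "b \<in> block_arc x ` {..<n}" "a \<noteq> b"
        "fst a < snd b" "fst b < snd a" for a b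
    proof -
      obtain i j where ij: "i < n" "a = block_arc x i" "j < n" "b = block_arc x j"
        using ab by auto
      then have "i \<noteq> j" using ab(3) by auto
      then show ?thesis using ij ab(4,5) left_arc_block[OF x] by auto
    qed
  qed simp
  then have blocks: "block_arc x i = block_arc y i" if "i < n" for i
    using that by (simp add: map_eq_conv)
  have "x j = y j" for j
  proof (cases "j \<in> {1..2 * n}")
    case True
    show ?thesis
    proof (cases "even j")
      case True
      then have "2 * ((j - 2) div 2) + 2 = j" "(j - 2) div 2 < n" using \<open>j \<in> {1..2 * n}\<close> by auto
      then show ?thesis using blocks[of "(j - 2) div 2"] by (simp add: block_arc_def)
    next
      case False
      then have "2 * ((j - 1) div 2) + 1 = j" "(j - 1) div 2 < n" using \<open>j \<in> {1..2 * n}\<close> by auto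
      then show ?thesis using blocks[of "(j - 1) div 2"] by (simp add: block_arc_def)
    qed
  next
    case False
    then show ?thesis
      using alternating_permutationsD(1)[OF x] alternating_permutationsD(1)[OF y]
      by (metis permutes_not_in)
  qed
  then show "x = y" ..
qed

section \<open>Diagrams of alternating permutations\<close>

lemma continuous_interpolation:
  fixes f :: "nat \<Rightarrow> real"
  shows "\<exists>B. continuous_on UNIV B \<and> (\<forall>k\<le>m. B (real k) = f k)"
proof (intro exI conjI allI impI)
  \<comment> \<open>A combination of hat functions, each equal to 1 at its own integer and 0 at all
    others.\<close>
  let ?B = "\<lambda>y. \<Sum>k\<le>m. f k * max 0 (1 - \<bar>y - real k\<bar>)"
  show "continuous_on UNIV ?B"
    by (intro continuous_intros)
  fix k assume "k \<le> m"
  have "max 0 (1 - \<bar>real k - real j\<bar>) = (if j = k then 1 else 0)" for j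
    by (cases j k rule: linorder_cases) auto
  then show "?B (real k) = f k"
    using \<open>k \<le> m\<close> by (simp add: if_distrib[of "(*) _"] cong: if_cong)
qed

text \<open>If \<open>B\<close> is continuous and takes the value \<open>j\<close> at both points of block \<open>j\<close>, then the graphs
  of the functions \<open>y \<mapsto> i - B y\<close> are translates of each other, hence disjoint, and the \<open>i\<close>-th one
  passes the points of block \<open>j\<close> on the side given by the sign of \<open>i - j\<close>.\<close>

lemma alternating_permutation_diagram:
  assumes x: "x \<in> alternating_permutations n"
  shows "\<exists>D. noncrossing_arc_diagram (2 * n) D \<and> perfect_matching (2 * n) D \<and>
           arc_shape ` D = block_shape x ` {..<n}"
proof -
  \<comment> \<open>The number of the block containing the value \<open>k\<close>: positions
    \<open>2 * i + 1\<close> and \<open>2 * i + 2\<close> both give \<open>i\<close>.\<close>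
  define b where "b k = (inv x k - 1) div 2" for k
  have b: "b (x j) = (j - 1) div 2" for j
    using permutes_inverses(2)[OF alternating_permutationsD(1)[OF x]] by (simp add: b_def)
  obtain B where contB: "continuous_on UNIV B" and B: "\<And>k. k \<le> 2 * n \<Longrightarrow> B (real k) = real (b k)"
    using continuous_interpolation[of "2 * n" "\<lambda>k. real (b k)"] by blast
  define lo where "lo i = x (2 * i + 2)" for i
  define hi where "hi i = x (2 * i + 1)" for i
  define X where "X i y = real i - B y" for i :: nat and y
  define g where "g i = (\<lambda>t. Complex (X i (linepath (real (lo i)) (real (hi i)) t))
                                        (linepath (real (lo i)) (real (hi i)) t))" for i
  have lohi: "lo i < hi i" and range: "lo i \<in> {1..2 * n}" "hi i \<in> {1..2 * n}" if "i < n" for i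
    unfolding lo_def hi_def
    using alternating_permutationsD(2)[OF x that] alternating_permutations_range[OF x, of "2 * i + 2"]
      alternating_permutations_range[OF x, of "2 * i + 1"] that by auto
  have X_ends: "X i (real (lo i)) = 0" "X i (real (hi i)) = 0" if "i < n" for i
    using B range[OF that] b[of "2 * i + 2"] b[of "2 * i + 1"] by (auto simp: X_def lo_def hi_def)
  have start: "pathstart (g i) = point (lo i)" and finish: "pathfinish (g i) = point (hi i)"
    if "i < n" for i
    using X_ends[OF that] by (auto simp: g_def pathstart_def pathfinish_def linepath_def point_def)
  have image: "path_image (g i) = (\<lambda>y. Complex (X i y) y) ` {real (lo i)..real (hi i)}"
    if "i < n" for i
  proof -
    have "path_image (g i) =
        (\<lambda>y. Complex (X i y) y) ` (linepath (real (lo i)) (real (hi i)) ` {0..1})"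
      unfolding path_image_def g_def image_image ..
    then show ?thesis
      using lohi[OF that] by (simp add: linepath_image_01 closed_segment_eq_real_ivl)
  qed
  have disjoint: "path_image (g i) \<inter> path_image (g j) = {}" if "i < n" "j < n" "i \<noteq> j" for i j
    using that(3) unfolding image[OF that(1)] image[OF that(2)] by (auto simp: X_def)
  have block: "k \<in> x ` {1..2 * i} \<longleftrightarrow> b k < i" if "k \<in> {1..2 * n}" for k i
  proof -
    have "k \<in> x ` {1..2 * n}"
      using that by (simp only: permutes_image[OF alternating_permutationsD(1)[OF x]])
    then obtain j where j: "k = x j" "j \<in> {1..2 * n}" by (rule imageE)
    then show ?thesis
      using alternating_permutations_inj[OF x] by (auto simp: b image_iff)
  qed
  have X_sign: "X i (real k) > 0 \<longleftrightarrow> k \<in> x ` {1..2 * i}" "X i (real k) = 0 \<longleftrightarrow> b k = i"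
    if "k \<in> {1..2 * n}" for i k
    using block[OF that] B[of k] that by (auto simp: X_def)
  have between: "k \<in> {1..2 * n}" if "k \<in> {lo i<..<hi i}" "i < n" for i k
    using that range[of i] by auto
  have shape: "arc_shape (g i) = block_shape x i" if "i < n" for i
  proof -
    have "left_points (g i) = {k \<in> {lo i<..<hi i}. X i (real k) > 0}"
      by (rule left_points_graph) (use image X_ends that in auto)
    also have "\<dots> = {k \<in> {lo i<..<hi i}. k \<in> x ` {1..2 * i}}"
      using X_sign between[OF _ that] by blast
    finally show ?thesis
      using start finish that by (simp add: arc_shape_def block_shape_def lo_def hi_def)
  qed
  have arc: "is_arc (2 * n) (g i)" if i: "i < n" for i
    unfolding is_arc_def
  proof (intro exI conjI ballI)
    show "1 \<le> lo i" "lo i < hi i" "hi i \<le> 2 * n"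
      using range[OF i] lohi[OF i] by auto
    show "pathstart (g i) = point (lo i)" "pathfinish (g i) = point (hi i)"
      using start finish i by auto
    have "continuous_on UNIV (\<lambda>t. linepath (real (lo i)) (real (hi i)) t)"
      unfolding linepath_def by (intro continuous_intros)
    then have "continuous_on UNIV (g i)"
      unfolding g_def X_def
      by (intro continuous_intros continuous_on_compose2[OF contB]) auto
    then show "path (g i)"
      unfolding path_def by (rule continuous_on_subset) simp
    show "strict_mono_on {0..1} (\<lambda>t. Im (g i t))"
    proof (rule strict_mono_onI)
      fix s t :: real assume "s < t"
      then have "s * (real (hi i) - real (lo i)) < t * (real (hi i) - real (lo i))"
        using lohi[OF i] by simp
      then show "Im (g i s) < Im (g i t)"
        by (simp add: g_def linepath_def algebra_simps)
    qed
    fix k assume k: "k \<in> {lo i<..<hi i}"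
    obtain j where j: "k = x j"
      using permutes_surj[OF alternating_permutationsD(1)[OF x]] by (metis surjD)
    have "b k \<noteq> i"
    proof
      assume "b k = i"
      \<comment> \<open>This excludes \<open>j = 0\<close>, which truncated subtraction would also
        assign to block 0.\<close>
      moreover have "j \<in> {1..2 * n}"
        using permutes_in_image[OF alternating_permutationsD(1)[OF x], of j] between[OF k i] j by simp
      ultimately have "(j - 1) div 2 = i" "1 \<le> j" using b j by auto
      then have "j = 2 * i + 1 \<or> j = 2 * i + 2" by presburger
      then have "k = hi i \<or> k = lo i" unfolding j lo_def hi_def by blast
      then show False using k by auto
    qed
    then have "X i (real k) \<noteq> 0"
      using X_sign(2)[OF between[OF k i]] by simp
    then show "point k \<notin> path_image (g i)"
      unfolding image[OF i] by (auto simp: point_def)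
  qed
  define D where "D = g ` {..<n}"
  have apart: "path_image f \<inter> path_image h = {}" if fh: "f \<in> D" "h \<in> D" "f \<noteq> h" for f h
    using fh disjoint unfolding D_def by blast
  have "noncrossing_arc_diagram (2 * n) D"
    unfolding noncrossing_arc_diagram_def
  proof (intro conjI ballI pairwiseI)
    show "is_arc (2 * n) f" if "f \<in> D" for f using that arc by (auto simp: D_def)
    fix f h assume fh: "f \<in> D" "h \<in> D" "f \<noteq> h"
    note e = apart[OF fh]
    show "path_image f \<inter> path_image h \<subseteq> {pathstart f, pathfinish f} \<inter> {pathstart h, pathfinish h}"
      using e by simp
    show "pathstart f \<noteq> pathstart h"
      using e pathstart_in_path_image[of f] pathstart_in_path_image[of h] by auto
    show "pathfinish f \<noteq> pathfinish h"
      using e pathfinish_in_path_image[of f] pathfinish_in_path_image[of h] by auto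
  qed
  moreover have "perfect_matching (2 * n) D"
    unfolding perfect_matching_def
  proof (intro conjI ballI pairwiseI)
    show "disjnt (path_image f) (path_image h)" if "f \<in> D" "h \<in> D" "f \<noteq> h" for f h
      using apart[OF that] by (simp add: disjnt_def)
    fix k assume "k \<in> {1..2 * n}"
    then have "k \<in> x ` {1..2 * n}"
      using permutes_image[OF alternating_permutationsD(1)[OF x]] by simp
    then obtain i where "i < n" "k = hi i \<or> k = lo i"
      unfolding image_blocks lo_def hi_def by auto
    then show "\<exists>f\<in>D. point k \<in> {pathstart f, pathfinish f}"
      using start finish by (auto simp: D_def)
  qed
  moreover have "arc_shape ` D = block_shape x ` {..<n}"
    using shape by (simp add: D_def image_image)
  ultimately show ?thesis by blast
qed

section \<open>Alternating permutations of diagrams\<close>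

lemma diagram_alternating_permutation:
  assumes noncrossing: "noncrossing_arc_diagram (2 * n) D" and matching: "perfect_matching (2 * n) D"
  shows "\<exists>x\<in>alternating_permutations n. block_shape x ` {..<n} = arc_shape ` D"
proof -
  have "\<forall>g\<in>D. \<exists>p q X. arc_graph (2 * n) g p q X"
    using noncrossing is_arc_imp_arc_graph unfolding noncrossing_arc_diagram_def by blast
  then obtain lo hi X where "\<forall>g\<in>D. arc_graph (2 * n) g (lo g) (hi g) (X g)"
    by metis
  then have graph: "\<forall>g\<in>D. 1 \<le> lo g \<and> lo g < hi g \<and> hi g \<le> 2 * n \<and>
    pathstart g = point (lo g) \<and> pathfinish g = point (hi g) \<and>
    continuous_on {real (lo g)..real (hi g)} (X g) \<and>
    path_image g = (\<lambda>y. Complex (X g y) y) ` {real (lo g)..real (hi g)} \<and>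
    X g (real (lo g)) = 0 \<and> X g (real (hi g)) = 0"
    by (simp add: arc_graph_def)
  have apart: "path_image g \<inter> path_image h = {}" if "g \<in> D" "h \<in> D" "g \<noteq> h" for g h
    using matching that by (auto simp: perfect_matching_def pairwise_def disjnt_def)
  have ends: "{lo g, hi g} \<inter> {lo h, hi h} = {}" if gh: "g \<in> D" "h \<in> D" "g \<noteq> h" for g h
  proof -
    have "point k \<in> path_image f" if "f \<in> D" "k \<in> {lo f, hi f}" for f k
      using graph that pathstart_in_path_image[of f] pathfinish_in_path_image[of f] by auto
    then show ?thesis using apart[OF gh] gh by blast
  qed
  have X_neq: "X g y \<noteq> X h y"
    if "g \<in> D" "h \<in> D" "g \<noteq> h" "y \<in> {real (lo g)..real (hi g)}" "y \<in> {real (lo h)..real (hi h)}"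
    for g h y
  proof
    assume "X g y = X h y"
    moreover have "Complex (X g y) y \<in> path_image g" "Complex (X h y) y \<in> path_image h"
      using graph that by auto
    ultimately show False using apart[OF that(1-3)] by auto
  qed
  \<comment> \<open>Two disjoint continuous graphs keep their left-to-right order on the whole
    interval \<open>{?a..?b}\<close> of common heights.\<close>
  have X_less: "X g z < X h z"
    if gh: "g \<in> D" "h \<in> D" and yz: "y \<in> {real (lo g)..real (hi g)}" "y \<in> {real (lo h)..real (hi h)}"
      "z \<in> {real (lo g)..real (hi g)}" "z \<in> {real (lo h)..real (hi h)}" and less: "X g y < X h y"
    for g h y z
  proof -
    let ?a = "max (real (lo g)) (real (lo h))" and ?b = "min (real (hi g)) (real (hi h))"
    have "continuous_on {real (lo g)..real (hi g)} (X g)" "continuous_on {real (lo h)..real (hi h)} (X h)"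
      using graph gh by blast+
    then have cont: "continuous_on {?a..?b} (X g)" "continuous_on {?a..?b} (X h)"
      by (auto elim: continuous_on_subset)
    have neq: "X g t \<noteq> X h t" if "t \<in> {?a..?b}" for t
      using X_neq[OF gh, of t] less that by auto
    have mem: "y \<in> {?a..?b}" "z \<in> {?a..?b}" using yz by auto
    show ?thesis
      by (rule nonvanishing_difference_sign[OF cont neq mem less])
  qed

  \<comment> \<open>One witnessing height suffices, since the order is the same at all common
    heights.\<close>
  define L where "L g h \<longleftrightarrow> lo g < hi h \<and> lo h < hi g \<and>
    (\<exists>y\<in>{real (lo g)..real (hi g)} \<inter> {real (lo h)..real (hi h)}. X g y < X h y)" for g h
  have L_iff: "L g h \<longleftrightarrow> X g y < X h y"
    if "g \<in> D" "h \<in> D" "lo g < hi h" "lo h < hi g"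
      "y \<in> {real (lo g)..real (hi g)}" "y \<in> {real (lo h)..real (hi h)}" for g h y
    using X_less[OF that(1,2) _ _ that(5,6)] that(3-6) by (auto simp: L_def)
  have lohi: "lo g < hi g" if "g \<in> D" for g using graph that by blast
  \<comment> \<open>Finiteness is not part of the definition of a diagram; it follows from the
    distinct lower endpoints in a bounded range.\<close>
  have finD: "finite D"
  proof (rule finite_imageD)
    have "lo ` D \<subseteq> {..2 * n}" using graph by fastforce
    then show "finite (lo ` D)" by (rule finite_subset) simp
    show "inj_on lo D" using ends by (auto intro!: inj_onI)
  qed
  have "\<exists>gs. admissible_order lo hi L D gs"
  proof (rule admissible_order_exists[OF finD lohi])
    fix g h assume gh: "g \<in> D" "h \<in> D" "L g h"
    let ?y = "real (max (lo g) (lo h))"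
    have o: "lo g < hi h" "lo h < hi g" using gh(3) by (auto simp: L_def)
    then have y: "?y \<in> {real (lo g)..real (hi g)}" "?y \<in> {real (lo h)..real (hi h)}"
      using lohi gh by (auto simp: less_imp_le)
    have "X g ?y < X h ?y" using L_iff[OF gh(1,2) o y] gh(3) by simp
    then show "lo g < hi h \<and> lo h < hi g \<and> \<not> L h g"
      using L_iff[OF gh(2,1) o(2,1) y(2,1)] o by auto
  next
    fix f g h assume inD: "f \<in> D" "g \<in> D" "h \<in> D" and L: "L f g" "L g h"
      and fh: "lo f < hi h" "lo h < hi f"
    \<comment> \<open>Three pairwise overlapping intervals share the largest of their lower ends; at
      that height the three values of \<open>X\<close> are compared directly.\<close>
    let ?y = "real (max (lo f) (max (lo g) (lo h)))"
    have o: "lo f < hi g" "lo g < hi f" "lo g < hi h" "lo h < hi g"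
      using L by (auto simp: L_def)
    have y: "?y \<in> {real (lo f)..real (hi f)}" "?y \<in> {real (lo g)..real (hi g)}"
      "?y \<in> {real (lo h)..real (hi h)}"
      using lohi inD o fh by (auto simp: less_imp_le)
    show "L f h"
      using L_iff[OF inD(1,2) o(1,2) y(1,2)] L_iff[OF inD(2,3) o(3,4) y(2,3)]
        L_iff[OF inD(1,3) fh y(1,3)] L by simp
  qed auto
  then obtain gs where gs: "distinct gs" "set gs = D" "sorted_wrt (\<lambda>a b. \<not> L b a) gs"
    "successively (\<lambda>a b. lo a < hi b) gs"
    by (auto simp: admissible_order_def)

  have cover: "(\<Union>g\<in>D. {lo g, hi g}) = {1..2 * n}"
  proof
    show "(\<Union>g\<in>D. {lo g, hi g}) \<subseteq> {1..2 * n}" using graph by fastforce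
    show "{1..2 * n} \<subseteq> (\<Union>g\<in>D. {lo g, hi g})"
      using matching graph unfolding perfect_matching_def by fastforce
  qed
  \<comment> \<open>The disjoint endpoint pairs cover \<open>2 * n\<close> points, so there are
    exactly \<open>n\<close> arcs.\<close>
  have "card (\<Union>g\<in>D. {lo g, hi g}) = (\<Sum>g\<in>D. card {lo g, hi g})"
    using finD ends by (intro card_UN_disjoint) auto
  also have "\<dots> = (\<Sum>g\<in>D. 2)"
    using lohi by (intro sum.cong) (auto simp: card_insert_if less_imp_neq)
  finally have len: "length gs = n"
    using cover distinct_card[OF gs(1)] gs(2) by simp
  have D: "D = (!) gs ` {..<n}"
    using gs(2) len by (auto simp: set_conv_nth)
  have nth: "gs ! i \<in> D" if "i < n" for i using that D by auto

  \<comment> \<open>The arcs are written out in admissible order, upper endpoint first. Position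
    \<open>j\<close> belongs to arc number \<open>(j - 1) div 2\<close>; outside the range
    \<open>x\<close> is the identity, as \<open>permutes\<close> demands.\<close>
  define x where
    "x j = (if j \<in> {1..2 * n} then (if odd j then hi else lo) (gs ! ((j - 1) div 2)) else j)" for j
  have x: "x (2 * i + 1) = hi (gs ! i)" "x (2 * i + 2) = lo (gs ! i)" if "i < n" for i
    using that by (auto simp: x_def)
  have x_image: "x ` {1..2 * i} = (\<Union>j<i. {hi (gs ! j), lo (gs ! j)})" if "i \<le> n" for i
    unfolding image_blocks using that x by (intro SUP_cong) auto
  have x_range: "x ` {1..2 * n} = {1..2 * n}"
  proof -
    have "x ` {1..2 * n} = (\<Union>g\<in>D. {hi g, lo g})"
      unfolding x_image[OF order.refl] D by simp
    then show ?thesis using cover by (simp add: insert_commute)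
  qed
  have "bij_betw x {1..2 * n} {1..2 * n}"
    using x_range by (auto simp: bij_betw_def intro: finite_surj_inj)
  then have "x permutes {1..2 * n}"
    by (rule bij_imp_permutes) (auto simp: x_def)
  moreover have "if odd i then x i > x (i + 1) else x i < x (i + 1)" if i: "i \<in> {1..<2 * n}" for i
  proof (cases "odd i")
    case True
    then obtain j where j: "i = 2 * j + 1" by (elim oddE)
    then have "j < n" using i by auto
    then show ?thesis using x[of j] lohi[OF nth] j by simp
  next
    case False
    define j where "j = (i - 2) div 2"
    then have j: "i = 2 * j + 2" "Suc j < n" using i False by auto
    then have "lo (gs ! j) < hi (gs ! Suc j)"
      using gs(4) len by (simp add: successively_conv_nth)
    then show ?thesis using x(2)[of j] x(1)[of "Suc j"] j by simp
  qed
  ultimately have alt: "x \<in> alternating_permutations n"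
    unfolding alternating_permutations_def by blast

  \<comment> \<open>Overlapping arcs are comparable, and sortedness of \<open>gs\<close> leaves only
    one direction.\<close>
  have L_order: "L (gs ! j) (gs ! i) \<longleftrightarrow> j < i"
    if ij: "i < n" "j < n" "i \<noteq> j" "lo (gs ! i) < hi (gs ! j)" "lo (gs ! j) < hi (gs ! i)" for i j
  proof -
    let ?y = "real (max (lo (gs ! i)) (lo (gs ! j)))"
    have y: "?y \<in> {real (lo (gs ! i))..real (hi (gs ! i))}" "?y \<in> {real (lo (gs ! j))..real (hi (gs ! j))}"
      using lohi[OF nth[OF ij(1)]] lohi[OF nth[OF ij(2)]] ij by (auto simp: less_imp_le)
    have "gs ! i \<noteq> gs ! j" using gs(1) ij len by (simp add: nth_eq_iff_index_eq)
    then have "L (gs ! j) (gs ! i) \<or> L (gs ! i) (gs ! j)"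
      using X_neq[OF nth[OF ij(1)] nth[OF ij(2)] _ y] L_iff[OF nth[OF ij(2)] nth[OF ij(1)] ij(5,4) y(2,1)]
        L_iff[OF nth[OF ij(1)] nth[OF ij(2)] ij(4,5) y] by linarith
    then show ?thesis
      using gs(3) ij len by (metis linorder_neqE_nat sorted_wrt_iff_nth_less)
  qed
  have "block_shape x i = arc_shape (gs ! i)" if i: "i < n" for i
  proof -
    let ?g = "gs ! i"
    have "(k \<in> x ` {1..2 * i}) \<longleftrightarrow> X ?g (real k) > 0" if k: "k \<in> {lo ?g<..<hi ?g}" for k
    proof -
      have "k \<in> {1..2 * n}" using k graph nth[OF i] by fastforce
      then obtain j where j: "j < n" "k \<in> {lo (gs ! j), hi (gs ! j)}"
        unfolding cover[symmetric] D by auto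
      have "j \<noteq> i" using j k by auto
      have y: "real k \<in> {real (lo ?g)..real (hi ?g)}" "real k \<in> {real (lo (gs ! j))..real (hi (gs ! j))}"
        using k j lohi[OF nth[OF j(1)]] by auto
      have o: "lo ?g < hi (gs ! j)" "lo (gs ! j) < hi ?g"
        using k j(2) lohi[OF nth[OF j(1)]] by auto
      \<comment> \<open>Arc \<open>j\<close> meets the axis at its endpoint \<open>k\<close>, so the
        sign of \<open>X ?g\<close> at that height tells which of the two arcs is on the
        left.\<close>
      have "X (gs ! j) (real k) = 0" using graph nth[OF j(1)] j(2) by auto
      then have "X ?g (real k) > 0 \<longleftrightarrow> j < i"
        using L_iff[OF nth[OF j(1)] nth[OF i] o(2,1) y(2,1)] L_order[OF i j(1) _ o] \<open>j \<noteq> i\<close> by simp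
      moreover have "k \<in> {hi (gs ! l), lo (gs ! l)} \<longleftrightarrow> l = j" if "l < n" for l
      proof
        assume "k \<in> {hi (gs ! l), lo (gs ! l)}"
        then have "gs ! l = gs ! j"
          using ends[OF nth[OF that] nth[OF j(1)]] j(2) by blast
        then show "l = j" using gs(1) that j(1) len by (simp add: nth_eq_iff_index_eq)
      qed (use j in auto)
      ultimately show ?thesis
        using x_image[of i] i by auto
    qed
    moreover have "left_points ?g = {k \<in> {lo ?g<..<hi ?g}. X ?g (real k) > 0}"
      by (rule left_points_graph) (use graph nth[OF i] in auto)
    ultimately show ?thesis
      using graph nth[OF i] x[OF i] by (auto simp: block_shape_def arc_shape_def)
  qed
  then have "block_shape x ` {..<n} = arc_shape ` D"
    unfolding D image_image by (intro image_cong) auto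
  then show ?thesis using alt by blast
qed

section \<open>Passage from shapes to equivalence classes of diagrams\<close>

lemma diagram_equiv_class_eq:
  assumes "noncrossing_arc_diagram m D"
  shows "diagram_equiv m `` {D} = {E. noncrossing_arc_diagram m E \<and> arc_shape ` E = arc_shape ` D}"
  using assms by (auto simp: diagram_equiv_def)

theorem theorem3p9:
  fixes n :: nat
  assumes "n \<ge> 1"
  shows "\<exists>f. bij_betw f (alternating_permutations n) (perfect_matching_diagrams (2 * n))"
proof (intro exI bij_betw_imageI)
  \<comment> \<open>On the shape set of a matching diagram, \<open>F\<close> is its equivalence
    class, so the bijection needs no choice of representative.\<close>
  define F where
    "F T = {E. noncrossing_arc_diagram (2 * n) E \<and> arc_shape ` E = T}" for T
  let ?A = "alternating_permutations n" and ?S = "\<lambda>x. block_shape x ` {..<n}"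
  let ?M = "{D. noncrossing_arc_diagram (2 * n) D \<and> perfect_matching (2 * n) D}"
  have class_F: "diagram_equiv (2 * n) `` {D} = F (arc_shape ` D)" if "D \<in> ?M" for D
    using diagram_equiv_class_eq that by (simp add: F_def)
  show "inj_on (\<lambda>x. F (?S x)) ?A"
  proof (rule inj_onI)
    fix x y assume x: "x \<in> ?A" and y: "y \<in> ?A" and eq: "F (?S x) = F (?S y)"
    \<comment> \<open>A realizing diagram is essential: \<open>F\<close> sends every unrealized set
      of shapes to the empty set.\<close>
    obtain D where D: "D \<in> F (?S x)"
      using alternating_permutation_diagram[OF x] by (auto simp: F_def)
    moreover have "D \<in> F (?S y)" using D eq by simp
    ultimately have "?S x = ?S y" by (simp add: F_def)
    then show "x = y" using inj_onD[OF inj_on_block_shapes] x y by blast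
  qed
  \<comment> \<open>The two constructions, from permutations to diagrams and back, supply the two
    inclusions.\<close>
  have shapes: "?S ` ?A = image arc_shape ` ?M"
  proof
    show "?S ` ?A \<subseteq> image arc_shape ` ?M"
      using alternating_permutation_diagram by (fastforce simp: image_iff)
    show "image arc_shape ` ?M \<subseteq> ?S ` ?A"
      using diagram_alternating_permutation by (fastforce simp: image_iff)
  qed
  have "(\<lambda>x. F (?S x)) ` ?A = F ` (?S ` ?A)" by (simp add: image_image)
  also have "\<dots> = (\<lambda>D. diagram_equiv (2 * n) `` {D}) ` ?M"
    unfolding shapes image_image using class_F by simp
  also have "\<dots> = perfect_matching_diagrams (2 * n)"
    by (auto simp: perfect_matching_diagrams_def quotient_def)
  finally show "(\<lambda>x. F (?S x)) ` ?A = perfect_matching_diagrams (2 * n)" .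
qed

end
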